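(* For $n\ge3$, the characteristic polynomial of the Coxeter transformation of the diagram $T_{3,3,n}$, taken up to sign, is $$\chi(T_{3,3,n})=\lambda^{n+4}+\lambda^{n+3}-2\lambda^{n+1}-3\sum_{i=4}^{n}\lambda^i-2\lambda^3+\lambda+1$$ (the sum being empty for $n=3$), in other words $$\chi(T_{3,3,n})=\frac{\lambda^{n+1}(\lambda^4-\lambda^2-2\lambda-1)+(\lambda^4+2\lambda^3+\lambda^2-1)}{\lambda-1}=\frac{(\lambda^2+\lambda+1)\big[\lambda^{n+1}(\lambda^2-\lambda-1)+(\lambda^2+\lambda-1)\big]}{\lambda-1}.$$ As $n\to\infty$, the spectral radius $\rho(T_{3,3,n})$ of the Coxeter transformation converges to the maximal root $\rho_{max}$ of the equation $\lambda^2-\lambda-1=0$, that is, $\rho_{max}=\frac{\sqrt5+1}{2}\approx1.618034$.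
   Context: $T_{p,q,r}$ is the simply-laced star-shaped tree with three branches having $p,q,r$ vertices respectively, each count including the common branch vertex (so $p+q+r-2$ vertices in total). The Coxeter transformation of a tree with Cartan matrix $K$ is the product of all simple reflections $\sigma_v(z)=z-(Kz)_v\alpha_v$, each taken once, in some order; for a tree all such products are conjugate. *)

theory Defs
  imports
    "Jordan_Normal_Form.Spectral_Radius"
    "HOL-Computational_Algebra.Polynomial_Factorial"
begin

(* The star T_{p,q,r} (p, q, r >= 1) has vertex set {..<p + q + r - 2}. The branch vertex is 0, and
   the vertices other than 0 on the three branches, listed from the centre outwards, are
     1, ..., p - 1;   p, ..., p + q - 2;   p + q - 1, ..., p + q + r - 3.
   The neighbour of v > 0 in the direction of the branch vertex is star_parent p q v. *)

definition star_size :: "nat \<Rightarrow> nat \<Rightarrow> nat \<Rightarrow> nat" where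
  "star_size p q r = p + q + r - 2"

definition star_parent :: "nat \<Rightarrow> nat \<Rightarrow> nat \<Rightarrow> nat" where
  "star_parent p q v = (if v = 1 \<or> v = p \<or> v = p + q - 1 then 0 else v - 1)"

definition star_adj :: "nat \<Rightarrow> nat \<Rightarrow> nat \<Rightarrow> nat \<Rightarrow> bool" where
  "star_adj p q i j \<longleftrightarrow> (0 < i \<and> j = star_parent p q i) \<or> (0 < j \<and> i = star_parent p q j)"

definition cartan_matrix :: "nat \<Rightarrow> (nat \<Rightarrow> nat \<Rightarrow> bool) \<Rightarrow> int mat" where
  "cartan_matrix N adj = mat N N (\<lambda>(i, j). if i = j then 2 else if adj i j then -1 else 0)"

definition star_cartan :: "nat \<Rightarrow> nat \<Rightarrow> nat \<Rightarrow> int mat" where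
  "star_cartan p q r = cartan_matrix (star_size p q r) (star_adj p q)"

(* Matrices act on column vectors of coordinates in the basis of simple roots, so that alpha_v is
   the unit vector with index v. The matrix below is that of z \<mapsto> z - (K z)_v alpha_v. *)

definition simple_reflection :: "int mat \<Rightarrow> nat \<Rightarrow> int mat" where
  "simple_reflection K v =
     1\<^sub>m (dim_row K) - mat (dim_row K) (dim_row K) (\<lambda>(i, j). if i = v then K $$ (v, j) else 0)"

lemma simple_reflection_carrier:
  assumes "K \<in> carrier_mat N N"
  shows "simple_reflection K v \<in> carrier_mat N N"
  using assms by (auto simp: simple_reflection_def)

lemma simple_reflection_mult_vec:
  assumes K: "K \<in> carrier_mat N N" and v: "v < N" and z: "z \<in> carrier_vec N"
  shows "simple_reflection K v *\<^sub>v z = z - ((K *\<^sub>v z) $ v) \<cdot>\<^sub>v unit_vec N v"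
proof (rule eq_vecI)
  let ?M = "mat N N (\<lambda>(i, j). if i = v then K $$ (v, j) else 0)"
  have dim: "dim_row K = N" "dim_col K = N" "dim_vec z = N"
    using K z by auto
  have "simple_reflection K v *\<^sub>v z = 1\<^sub>m N *\<^sub>v z - ?M *\<^sub>v z"
    unfolding simple_reflection_def dim
    by (rule minus_mult_distrib_mat_vec) (use z in auto)
  then have split: "simple_reflection K v *\<^sub>v z = z - ?M *\<^sub>v z"
    using z by simp
  fix i
  assume "i < dim_vec (z - ((K *\<^sub>v z) $ v) \<cdot>\<^sub>v unit_vec N v)"
  then have i: "i < N" by simp
  show "(simple_reflection K v *\<^sub>v z) $ i = (z - ((K *\<^sub>v z) $ v) \<cdot>\<^sub>v unit_vec N v) $ i"
    unfolding split using i v dim by (auto simp: scalar_prod_def)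
next
  show "dim_vec (simple_reflection K v *\<^sub>v z) = dim_vec (z - ((K *\<^sub>v z) $ v) \<cdot>\<^sub>v unit_vec N v)"
    using K by (simp add: simple_reflection_def)
qed

definition is_coxeter_transformation :: "int mat \<Rightarrow> int mat \<Rightarrow> bool" where
  "is_coxeter_transformation K C \<longleftrightarrow>
     (\<exists>vs. distinct vs \<and> set vs = {..<dim_row K} \<and>
        C = foldr (\<lambda>v A. simple_reflection K v * A) vs (1\<^sub>m (dim_row K)))"

end

theory Submission
  imports Defs
begin

text \<open>
  Fix the order in which the reflections are multiplied, and split the Cartan matrix \<open>K\<close> as \<open>U + L\<close>,
  where both summands have unit diagonal and an off-diagonal entry \<open>K\<^sub>i\<^sub>j\<close> goes to \<open>U\<close> if \<open>i\<close> precedes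
  \<open>j\<close> in this order and to \<open>L\<close> otherwise. Tracking how each reflection changes a single row gives
  \<open>U C = -L\<close> for the Coxeter transformation \<open>C\<close>, whence \<open>U (x 1 - C) = x U + L\<close> and
  \<open>det U \<cdot> char_poly C = det (x U + L)\<close> (lemma \<open>det_mult_char_poly_reflection_product\<close>).

  The matrix \<open>x U + L\<close> has \<open>x + 1\<close> on the diagonal and is otherwise supported on the edges of the
  star. Its determinant is found by removing leaves (\<open>det_attach_leaf\<close>), and a leaf removal sees the
  two entries of an edge only through their product, which is \<open>x\<close> whichever endpoint comes first.
  This is why the order is irrelevant. The resulting recursion along the long branch is solved in
  \<open>det_star_weighting\<close>, over an arbitrary commutative ring. Replacing \<open>x\<close> by \<open>0\<close> there shows that
  \<open>det U = 1\<close> as well: \<open>U\<close> has unit diagonal and the product of its entries over each edge is \<open>0\<close>.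

  An eigenvalue \<open>z \<noteq> 1\<close> is thus a root of \<open>z\<^sup>2 + z + 1\<close>, and then of modulus \<open>1\<close>, or a solution of
  \<open>z ^ (n + 1) * (z\<^sup>2 - z - 1) + (z\<^sup>2 + z - 1) = 0\<close>. For large \<open>n\<close> and \<open>norm z\<close> bounded away from \<open>1\<close>
  from above, the first term dominates unless \<open>z\<close> is close to a root of \<open>z\<^sup>2 - z - 1\<close>. Hence no
  solution is much larger than the golden ratio (\<open>no_large_roots\<close>), while a sign change produces a
  real solution just below it (\<open>root_near_golden\<close>).
\<close>

section \<open>Products of reflections\<close>

fun precedes :: "'a list \<Rightarrow> 'a \<Rightarrow> 'a \<Rightarrow> bool" where
  "precedes [] i j \<longleftrightarrow> False"
| "precedes (v # vs) i j \<longleftrightarrow> i = v \<and> j \<in> set vs \<or> precedes vs i j"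

lemma precedes_in_set: "precedes vs i j \<Longrightarrow> i \<in> set vs \<and> j \<in> set vs"
  by (induction vs) auto

lemma precedes_swap:
  assumes "distinct vs" "i \<in> set vs" "j \<in> set vs" "i \<noteq> j"
  shows "precedes vs j i \<longleftrightarrow> \<not> precedes vs i j"
  using assms by (induction vs) (auto dest: precedes_in_set)

lemma simple_reflection_mult_index:
  assumes K: "K \<in> carrier_mat N N" and B: "B \<in> carrier_mat N N"
    and "v < N" "i < N" "k < N"
  shows "(simple_reflection K v * B) $$ (i, k)
       = B $$ (i, k) - (if i = v then \<Sum>j<N. K $$ (v, j) * B $$ (j, k) else 0)"
proof -
  let ?M = "mat N N (\<lambda>(i, j). if i = v then K $$ (v, j) else 0)"
  have "simple_reflection K v * B = 1\<^sub>m N * B - ?M * B"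
    unfolding simple_reflection_def using K B
    by (simp add: minus_mult_distrib_mat[of _ N N])
  then have split: "simple_reflection K v * B = B - ?M * B"
    using B by simp
  have "(?M * B) $$ (i, k) = (\<Sum>j<N. (if i = v then K $$ (v, j) else 0) * B $$ (j, k))"
    using assms by (simp add: scalar_prod_def atLeast0LessThan)
  also have "\<dots> = (if i = v then \<Sum>j<N. K $$ (v, j) * B $$ (j, k) else 0)"
    by auto
  finally show ?thesis
    unfolding split using assms by simp
qed

abbreviation reflection_product :: "int mat \<Rightarrow> nat list \<Rightarrow> int mat" where
  "reflection_product K vs \<equiv>
     foldr (\<lambda>v A. simple_reflection K v * A) vs (1\<^sub>m (dim_row K))"

lemma reflection_product_carrier:
  assumes "K \<in> carrier_mat N N"
  shows "reflection_product K vs \<in> carrier_mat N N"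
  using assms
  by (induction vs) (auto intro!: mult_carrier_mat[of _ N N] simple_reflection_carrier)

lemma reflection_product_row_outside:
  assumes K: "K \<in> carrier_mat N N" and "set vs \<subseteq> {..<N}" and "i < N" "k < N" "i \<notin> set vs"
  shows "reflection_product K vs $$ (i, k) = (if i = k then 1 else 0)"
  using assms(2-)
proof (induction vs)
  case Nil
  then show ?case using K by auto
next
  case (Cons v vs)
  then show ?case
    using simple_reflection_mult_index[OF K reflection_product_carrier[OF K, of vs], of v i k]
    by auto
qed

text \<open>
  The matrix identity \<open>U C = -L\<close>, row by row. The leftmost reflection acts last, so when the one in
  \<open>i\<close> is applied, the rows of the vertices listed after \<open>i\<close> have their final value and all other rows,
  \<open>i\<close> included, are still those of the identity. The identity is stated for a product over any subset
  of the vertices, as induction on the list needs.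
\<close>

lemma reflection_product_row:
  assumes K: "K \<in> carrier_mat N N" and diag: "\<And>i. i < N \<Longrightarrow> K $$ (i, i) = 2"
    and "set vs \<subseteq> {..<N}" "distinct vs" and "i \<in> set vs" "k < N"
  defines "C \<equiv> reflection_product K vs"
  shows "C $$ (i, k) + (\<Sum>j<N. (if precedes vs i j then K $$ (i, j) else 0) * C $$ (j, k))
       = - (if i = k then 1 else if precedes vs i k then 0 else K $$ (i, k))"
  using assms(3-6) unfolding C_def
proof (induction vs)
  case Nil
  then show ?case by simp
next
  case (Cons v vs)
  define B where "B = reflection_product K vs"
  have v: "v < N" "v \<notin> set vs" and vs: "set vs \<subseteq> {..<N}" and i: "i < N"
    using Cons.prems by auto
  have B: "B \<in> carrier_mat N N"
    unfolding B_def by (rule reflection_product_carrier[OF K])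
  have C_index: "(simple_reflection K v * B) $$ (l, k)
      = B $$ (l, k) - (if l = v then \<Sum>j<N. K $$ (v, j) * B $$ (j, k) else 0)" if "l < N" for l
    using simple_reflection_mult_index[OF K B v(1) that \<open>k < N\<close>] .
  have B_out: "B $$ (l, k) = (if l = k then 1 else 0)" if "l < N" "l \<notin> set vs" for l
    unfolding B_def using reflection_product_row_outside[OF K vs] that \<open>k < N\<close> by blast
  have prod: "reflection_product K (v # vs) = simple_reflection K v * B"
    by (simp add: B_def)
  \<comment> \<open>Only row \<open>v\<close> changes under the reflection in \<open>v\<close>, and its coefficient here is \<open>0\<close>.\<close>
  have sum_eq: "(\<Sum>j<N. (if precedes (v # vs) i j then K $$ (i, j) else 0) *
                     (simple_reflection K v * B) $$ (j, k))
      = (\<Sum>j<N. (if precedes (v # vs) i j then K $$ (i, j) else 0) * B $$ (j, k))"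
    using v by (intro sum.cong) (auto simp: C_index dest: precedes_in_set)
  show ?case
  proof (cases "i = v")
    case False
    then have "i \<in> set vs" using Cons.prems by simp
    moreover have "precedes (v # vs) i j = precedes vs i j" for j
      using False by simp
    ultimately show ?thesis
      using Cons.IH vs Cons.prems False i
      unfolding prod sum_eq C_index[OF i] by (simp add: B_def)
  next
    case True
    have prec: "precedes (v # vs) v j \<longleftrightarrow> j \<in> set vs" for j
      using v precedes_in_set[of vs v j] by auto
    \<comment> \<open>Rows outside \<open>vs\<close> are unit rows, so the two sums differ by a single entry of \<open>K\<close>.\<close>
    have *: "(if j \<in> set vs then K $$ (v, j) else 0) * B $$ (j, k) - K $$ (v, j) * B $$ (j, k)
        = (if j = k then - (if k \<in> set vs then 0 else K $$ (v, k)) else 0)" if "j < N" for j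
      using B_out[OF that] by auto
    have "(\<Sum>j<N. (if j \<in> set vs then K $$ (v, j) else 0) * B $$ (j, k)) -
        (\<Sum>j<N. K $$ (v, j) * B $$ (j, k)) =
        (\<Sum>j<N. if j = k then - (if k \<in> set vs then 0 else K $$ (v, k)) else 0)"
      unfolding sum_subtractf[symmetric] by (intro sum.cong) (auto simp only: * lessThan_iff)
    also have "\<dots> = - (if k \<in> set vs then 0 else K $$ (v, k))"
      using \<open>k < N\<close> by simp
    finally show ?thesis
      unfolding prod sum_eq C_index[OF i] unfolding True prec
      using B_out[OF v] diag[OF v(1)] v by auto
  qed
qed

lemma det_mult_char_poly_reflection_product:
  assumes K: "K \<in> carrier_mat N N" and diag: "\<And>i. i < N \<Longrightarrow> K $$ (i, i) = 2"
    and vs: "distinct vs" "set vs = {..<N}"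
  shows "det (mat N N (\<lambda>(i, j). [:if i = j then 1 else if precedes vs i j then K $$ (i, j) else 0:]))
           * char_poly (reflection_product K vs)
       = det (mat N N (\<lambda>(i, j). if i = j then [:1, 1:]
                                else if precedes vs i j then [:0, K $$ (i, j):] else [:K $$ (i, j):]))"
    (is "det ?U * _ = det ?M")
proof -
  define C where "C = reflection_product K vs"
  have C: "C \<in> carrier_mat N N"
    unfolding C_def by (rule reflection_product_carrier[OF K])
  have irrefl: "\<not> precedes vs i i" for i
    using vs(1) by (induction vs) (auto dest: precedes_in_set)
  have "?U * char_poly_matrix C = ?M"
  proof (rule eq_matI)
    fix i k
    assume "i < dim_row ?M" "k < dim_col ?M"
    then have i: "i < N" and k: "k < N" by auto
    let ?u = "\<lambda>j. if i = j then 1 else if precedes vs i j then K $$ (i, j) else 0"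
    let ?p = "\<lambda>j. if precedes vs i j then K $$ (i, j) else 0"
    have "(\<Sum>j<N. ?u j * C $$ (j, k)) = (\<Sum>j<N. (if i = j then C $$ (j, k) else 0) + ?p j * C $$ (j, k))"
      by (intro sum.cong) (auto simp: irrefl)
    also have "\<dots> = C $$ (i, k) + (\<Sum>j<N. ?p j * C $$ (j, k))"
      using i by (simp add: sum.distrib)
    also have "\<dots> = - (if i = k then 1 else if precedes vs i k then 0 else K $$ (i, k))"
      unfolding C_def using reflection_product_row[OF K diag] vs i k by auto
    finally have row: "(\<Sum>j<N. ?u j * C $$ (j, k))
        = - (if i = k then 1 else if precedes vs i k then 0 else K $$ (i, k))" .
    have "(?U * char_poly_matrix C) $$ (i, k)
        = (\<Sum>j<N. [:?u j:] * ((if j = k then [:0, 1:] else 0) + [:- C $$ (j, k):]))"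
      using i k C
      by (auto simp: scalar_prod_def atLeast0LessThan char_poly_matrix_def intro!: sum.cong)
    also have "\<dots> = (\<Sum>j<N. (if j = k then [:0, ?u k:] else 0) + - [:?u j * C $$ (j, k):])"
      by (intro sum.cong) auto
    also have "\<dots> = [:0, ?u k:] - (\<Sum>j<N. [:?u j * C $$ (j, k):])"
      unfolding sum.distrib sum_negf using k by simp
    also have "(\<Sum>j<N. [:?u j * C $$ (j, k):]) = [:\<Sum>j<N. ?u j * C $$ (j, k):]"
      by (rule poly_eqI) (simp add: coeff_sum coeff_pCons split: nat.split)
    also have "[:0, ?u k:] - [:\<Sum>j<N. ?u j * C $$ (j, k):] = ?M $$ (i, k)"
      unfolding row using i k by simp
    finally show "(?U * char_poly_matrix C) $$ (i, k) = ?M $$ (i, k)" .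
  qed (use C carrier_matD[OF char_poly_matrix_closed[OF C]] in auto)
  then show ?thesis
    unfolding C_def[symmetric] char_poly_def
    using det_mult[of ?U N "char_poly_matrix C"] C by simp
qed

section \<open>Determinants of star-shaped matrices\<close>

text \<open>
  Vertex \<open>k\<close> is a leaf attached to \<open>u\<close>. Expanding along column \<open>k\<close> leaves the cofactors of \<open>(k, k)\<close> and
  \<open>(u, k)\<close>; in the second one row \<open>k\<close> has a single nonzero entry, in column \<open>u\<close>, and expanding along
  it deletes \<open>u\<close> altogether.
\<close>

lemma det_attach_leaf:
  fixes f :: "nat \<Rightarrow> nat \<Rightarrow> 'a :: comm_ring_1"
  assumes u: "u < k" and zero: "\<And>i. i < k \<Longrightarrow> i \<noteq> u \<Longrightarrow> f i k = 0 \<and> f k i = 0"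
  shows "det (mat (Suc k) (Suc k) (\<lambda>(i, j). f i j))
       = f k k * det (mat k k (\<lambda>(i, j). f i j))
         - f u k * f k u * det (mat_delete (mat k k (\<lambda>(i, j). f i j)) u u)"
proof -
  let ?A = "mat (Suc k) (Suc k) (\<lambda>(i, j). f i j)" and ?B = "mat k k (\<lambda>(i, j). f i j)"
  define X where "X = mat_delete ?A u k"
  have X: "X \<in> carrier_mat k k"
    unfolding X_def mat_delete_def by simp
  have Xlast: "X $$ (k - 1, j) = f k j" if "j < k" for j
    using that u by (auto simp: X_def mat_delete_def)
  have "det X = (\<Sum>j<k. X $$ (k - 1, j) * cofactor X (k - 1) j)"
    using u by (intro laplace_expansion_row[OF X]) simp
  also have "\<dots> = (\<Sum>j<k. if j = u then f k u * cofactor X (k - 1) u else 0)"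
    using zero u by (intro sum.cong) (auto simp: Xlast simp del: One_nat_def)
  also have "\<dots> = f k u * cofactor X (k - 1) u"
    using u by simp
  also have "mat_delete X (k - 1) u = mat_delete ?B u u"
    unfolding X_def mat_delete_def using u by (intro eq_matI) auto
  then have "cofactor X (k - 1) u = (-1) ^ (k - 1 + u) * det (mat_delete ?B u u)"
    by (simp add: cofactor_def)
  finally have detX: "det X = f k u * ((-1) ^ (k - 1 + u) * det (mat_delete ?B u u))" .
  have sign: "(-1) ^ (u + k) * (-1) ^ (k - 1 + u) = (-1 :: 'a)"
    using u by (cases k) (auto simp: power_add[symmetric] minus_one_power_iff)
  have last: "mat_delete ?A k k = ?B"
    unfolding mat_delete_def by (intro eq_matI) auto
  have "det ?A = (\<Sum>i<Suc k. ?A $$ (i, k) * cofactor ?A i k)"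
    by (intro laplace_expansion_column) auto
  also have "\<dots> = (\<Sum>i<k. ?A $$ (i, k) * cofactor ?A i k) + f k k * cofactor ?A k k"
    by simp
  also have "(\<Sum>i<k. ?A $$ (i, k) * cofactor ?A i k)
      = (\<Sum>i<k. if i = u then f u k * cofactor ?A u k else 0)"
    using zero by (intro sum.cong) auto
  also have "\<dots> = f u k * cofactor ?A u k"
    using u by simp
  also have "cofactor ?A u k = ((-1) ^ (u + k) * (-1) ^ (k - 1 + u)) * f k u * det (mat_delete ?B u u)"
    unfolding cofactor_def X_def[symmetric] detX by (simp add: ac_simps)
  also have "cofactor ?A k k = det ?B"
    unfolding cofactor_def last by (simp add: power_add[symmetric])
  finally show ?thesis
    unfolding sign by (simp add: algebra_simps)
qed

lemma det_attach_leaf_last: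
  fixes f :: "nat \<Rightarrow> nat \<Rightarrow> 'a :: comm_ring_1"
  assumes zero: "\<And>i. i < k \<Longrightarrow> f i (Suc k) = 0 \<and> f (Suc k) i = 0"
  shows "det (mat (Suc (Suc k)) (Suc (Suc k)) (\<lambda>(i, j). f i j))
       = f (Suc k) (Suc k) * det (mat (Suc k) (Suc k) (\<lambda>(i, j). f i j))
         - f k (Suc k) * f (Suc k) k * det (mat k k (\<lambda>(i, j). f i j))"
proof -
  have "mat_delete (mat (Suc k) (Suc k) (\<lambda>(i, j). f i j)) k k = mat k k (\<lambda>(i, j). f i j)"
    unfolding mat_delete_def by (intro eq_matI) auto
  then show ?thesis
    using det_attach_leaf[of k "Suc k" f] zero by simp
qed

lemma det_attach_leaf_first:
  fixes f :: "nat \<Rightarrow> nat \<Rightarrow> 'a :: comm_ring_1"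
  assumes zero: "\<And>i. 0 < i \<Longrightarrow> i \<le> k \<Longrightarrow> f i (Suc k) = 0 \<and> f (Suc k) i = 0"
  shows "det (mat (Suc (Suc k)) (Suc (Suc k)) (\<lambda>(i, j). f i j))
       = f (Suc k) (Suc k) * det (mat (Suc k) (Suc k) (\<lambda>(i, j). f i j))
         - f 0 (Suc k) * f (Suc k) 0 * det (mat k k (\<lambda>(i, j). f (Suc i) (Suc j)))"
proof -
  have "mat_delete (mat (Suc k) (Suc k) (\<lambda>(i, j). f i j)) 0 0 = mat k k (\<lambda>(i, j). f (Suc i) (Suc j))"
    unfolding mat_delete_def by (intro eq_matI) auto
  then show ?thesis
    using det_attach_leaf[of 0 "Suc k" f] zero by simp
qed

text \<open>
  The diagonal and the edge products are all that the determinant of a matrix supported on a tree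
  depends on, so this leaves open how \<open>x\<close> is distributed over the two entries of an edge.
\<close>

definition star_weighting :: "nat \<Rightarrow> 'a :: comm_ring_1 \<Rightarrow> (nat \<Rightarrow> nat \<Rightarrow> 'a) \<Rightarrow> bool" where
  "star_weighting N x f \<longleftrightarrow>
     (\<forall>i<N. f i i = x + 1) \<and>
     (\<forall>i<N. \<forall>j<N. i \<noteq> j \<longrightarrow> \<not> star_adj 3 3 i j \<longrightarrow> f i j = 0) \<and>
     (\<forall>i<N. \<forall>j<N. star_adj 3 3 i j \<longrightarrow> f i j * f j i = x)"

text \<open>
  The leading principal minors \<open>D\<close> satisfy \<open>D\<^sub>k\<^sub>+\<^sub>2 = (x + 1) D\<^sub>k\<^sub>+\<^sub>1 - x D\<^sub>k\<close> as long as each vertex is attached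
  to the previous one, a recursion with characteristic roots \<open>1\<close> and \<open>x\<close>; hence the shape of the
  result. The vertices \<open>3\<close> and \<open>5\<close>, which start the second and third branch, hang on the centre
  instead. For these the minors \<open>E\<close> of the graph without the centre take the place of \<open>D\<^sub>k\<close>.
\<close>

lemma det_star_weighting:
  fixes x :: "'a :: comm_ring_1"
  assumes f: "star_weighting N x f" and n: "n + 5 \<le> N"
  shows "(x - 1) * det (mat (n + 5) (n + 5) (\<lambda>(i, j). f i j))
       = (x ^ 2 + x + 1) * (x ^ (n + 2) * (x ^ 2 - x - 1) + (x ^ 2 + x - 1))"
proof -
  define D where "D k = det (mat k k (\<lambda>(i, j). f i j))" for k
  define E where "E k = det (mat k k (\<lambda>(i, j). f (Suc i) (Suc j)))" for k
  have diag: "f i i = x + 1" if "i < N" for i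
    using f that by (auto simp: star_weighting_def)
  have zero: "f i j = 0" "f j i = 0" if "i < j" "j < N" "i \<noteq> star_parent 3 3 j" for i j
  proof -
    have "star_parent 3 3 i \<le> i"
      by (simp add: star_parent_def)
    then have "star_parent 3 3 i \<noteq> j"
      using that(1) by simp
    then show "f i j = 0" "f j i = 0"
      using f that by (auto simp: star_weighting_def star_adj_def)
  qed
  have edge: "f i j * f j i = x" if "i < j" "j < N" "i = star_parent 3 3 j" for i j
  proof -
    have "star_adj 3 3 i j" "i < N"
      using that by (auto simp: star_adj_def)
    then show ?thesis
      using f \<open>j < N\<close> unfolding star_weighting_def by blast
  qed
  have D_chain: "D (Suc (Suc k)) = (x + 1) * D (Suc k) - x * D k"
    if "Suc k < N" "k \<notin> {2, 4}" for k
    unfolding D_def using that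
    by (subst det_attach_leaf_last) (auto simp: zero diag edge star_parent_def)
  have D_centre: "D (Suc (Suc k)) = (x + 1) * D (Suc k) - x * E k"
    if "Suc k < N" "k \<in> {2, 4}" for k
    unfolding D_def E_def using that
    by (subst det_attach_leaf_first) (auto simp: zero diag edge star_parent_def)
  have E_chain: "E (Suc (Suc k)) = (x + 1) * E (Suc k) - x * E k"
    if "Suc (Suc k) < N" "k \<in> {0, 2}" for k
    unfolding E_def using that
    by (subst det_attach_leaf_last) (auto simp: zero diag edge star_parent_def)
  \<comment> \<open>Without the centre, vertex \<open>3\<close> is isolated from the vertices before it.\<close>
  have E3: "E (Suc (Suc 1)) = (x + 1) * E (Suc 1)"
    unfolding E_def using n
    by (subst det_attach_leaf_first) (auto simp: zero diag star_parent_def)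
  have D01: "D 0 = 1" "D 1 = x + 1" and E01: "E 0 = 1" "E 1 = x + 1"
    unfolding D_def E_def using n by (simp_all add: det_single diag)
  have small: "D 2 = x ^ 2 + x + 1" "D 3 = (x + 1) * (x ^ 2 + 1)"
      "E 2 = x ^ 2 + x + 1" "E 3 = (x + 1) * (x ^ 2 + x + 1)"
      "D 4 = x ^ 4 + x ^ 3 + x ^ 2 + x + 1" "E 4 = (x ^ 2 + x + 1) ^ 2"
      "D 5 = x ^ 5 + x ^ 4 + x ^ 3 + x ^ 2 + x + 1"
  proof -
    show D2: "D 2 = x ^ 2 + x + 1" and E2: "E 2 = x ^ 2 + x + 1"
      using D_chain[of 0] E_chain[of 0] D01 E01 n
      by (simp_all add: numeral_2_eq_2 algebra_simps)
    show D3: "D 3 = (x + 1) * (x ^ 2 + 1)" and E3': "E 3 = (x + 1) * (x ^ 2 + x + 1)"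
      using D_chain[of 1] E3 D01 E01 D2 E2 n
      by (simp_all add: eval_nat_numeral algebra_simps)
    show D4: "D 4 = x ^ 4 + x ^ 3 + x ^ 2 + x + 1" and E4: "E 4 = (x ^ 2 + x + 1) ^ 2"
      using D_centre[of 2] E_chain[of 2] D3 E3' E2 n
      by (simp_all add: eval_nat_numeral algebra_simps)
    show "D 5 = x ^ 5 + x ^ 4 + x ^ 3 + x ^ 2 + x + 1"
      using D_chain[of 3] D3 D4 n
      by (simp add: eval_nat_numeral algebra_simps)
  qed
  have "(x - 1) * D (n + 5) = (x ^ 2 + x + 1) * (x ^ (n + 2) * (x ^ 2 - x - 1) + (x ^ 2 + x - 1))"
    using n
  proof (induction n rule: nat_less_induct)
    case (1 n)
    consider "n = 0" | "n = 1" | m where "n = Suc (Suc m)"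
      by (metis One_nat_def not0_implies_Suc)
    then show ?case
    proof cases
      case 1
      then show ?thesis
        unfolding \<open>n = 0\<close> add_0 small by (simp add: eval_nat_numeral algebra_simps)
    next
      case 2
      have "D 6 = (x + 1) * D 5 - x * E 4"
        using D_centre[of 4] 1 2 by (simp add: eval_nat_numeral)
      then have D6: "D (n + 5) = (x + 1) * (x ^ 5 + x ^ 4 + x ^ 3 + x ^ 2 + x + 1)
          - x * (x ^ 2 + x + 1) ^ 2"
        unfolding small using 2 by simp
      show ?thesis
        unfolding D6 unfolding 2 by (simp add: eval_nat_numeral algebra_simps)
    next
      case 3
      let ?F = "\<lambda>y. (x ^ 2 + x + 1) * (y * (x ^ 2 - x - 1) + (x ^ 2 + x - 1))"
      have IH: "(x - 1) * D (Suc (m + 5)) = ?F (x ^ (m + 3))" "(x - 1) * D (m + 5) = ?F (x ^ (m + 2))"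
        using 1 3 by (auto simp: eval_nat_numeral)
      have step: "D (n + 5) = (x + 1) * D (Suc (m + 5)) - x * D (m + 5)"
        using D_chain[of "m + 5"] "1.prems" 3 by simp
      have "(x - 1) * D (n + 5) = (x + 1) * ((x - 1) * D (Suc (m + 5))) - x * ((x - 1) * D (m + 5))"
        unfolding step by (simp add: algebra_simps)
      also have "\<dots> = ?F (x ^ (n + 2))"
        unfolding IH 3 by (simp add: power_add eval_nat_numeral algebra_simps)
      finally show ?thesis .
    qed
  qed
  then show ?thesis
    by (simp add: D_def)
qed


section \<open>The characteristic polynomial\<close>

lemma char_poly_star_3_3:
  fixes C :: "int mat" and n :: nat
  defines "x \<equiv> [:0, 1:] :: int poly"
  assumes C: "is_coxeter_transformation (star_cartan 3 3 n) C" and n: "n \<ge> 1"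
  shows "C \<in> carrier_mat (n + 4) (n + 4)"
    and "(x - 1) * char_poly C = (x ^ 2 + x + 1) * (x ^ (n + 1) * (x ^ 2 - x - 1) + (x ^ 2 + x - 1))"
proof -
  define K where "K = star_cartan 3 3 n"
  define N where "N = n + 4"
  have K: "K \<in> carrier_mat N N"
    by (rule carrier_matI)
      (simp_all add: K_def N_def star_cartan_def cartan_matrix_def star_size_def)
  have K_index: "K $$ (i, j) = (if i = j then 2 else if star_adj 3 3 i j then -1 else 0)"
    if "i < N" "j < N" for i j
    using that by (simp add: K_def N_def star_cartan_def cartan_matrix_def star_size_def)
  obtain vs where vs: "distinct vs" "set vs = {..<N}" and C_eq: "C = reflection_product K vs"
    using C K unfolding is_coxeter_transformation_def K_def by auto
  show "C \<in> carrier_mat (n + 4) (n + 4)"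
    unfolding C_eq using reflection_product_carrier[OF K] by (simp add: N_def)
  have adj: "\<not> star_adj 3 3 i i" "star_adj 3 3 i j \<longleftrightarrow> star_adj 3 3 j i" for i j
    by (auto simp: star_adj_def star_parent_def)
  have edge: "i \<noteq> j \<and> K $$ (i, j) = -1 \<and> K $$ (j, i) = -1 \<and>
      (precedes vs i j \<and> \<not> precedes vs j i \<or> precedes vs j i \<and> \<not> precedes vs i j)"
    if "i < N" "j < N" "star_adj 3 3 i j" for i j
  proof -
    have "i \<noteq> j" using that adj by blast
    then show ?thesis
      using precedes_swap[OF vs(1), of i j] vs(2) that adj(2)[of i j] by (auto simp: K_index)
  qed
  define u where "u i j = [:if i = j then 1 else if precedes vs i j then K $$ (i, j) else 0:]" for i j
  define m where "m i j = (if i = j then [:1, 1:]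
      else if precedes vs i j then [:0, K $$ (i, j):] else [:K $$ (i, j):])" for i j
  have u: "star_weighting N 0 u"
    unfolding star_weighting_def u_def by (auto simp: K_index dest: edge)
  have m: "star_weighting N x m"
    unfolding star_weighting_def
  proof (intro conjI allI impI)
    fix i j
    assume ij: "i < N" "j < N" "star_adj 3 3 i j"
    show "m i j * m j i = x"
      using edge[OF ij] by (auto simp: m_def x_def)
  qed (simp_all add: m_def K_index x_def one_pCons)
  have N: "n - 1 + 5 = N" "n - 1 + 2 = n + 1"
    using n by (auto simp: N_def)
  \<comment> \<open>At \<open>x = 0\<close> both sides of the determinant formula are the negatives of \<open>det U\<close> and \<open>1\<close>.\<close>
  have "det (mat N N (\<lambda>(i, j). u i j)) = 1"
    using det_star_weighting[OF u, of "n - 1"] unfolding N by simp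
  then have "char_poly C = det (mat N N (\<lambda>(i, j). m i j))"
    using det_mult_char_poly_reflection_product[OF K _ vs] unfolding C_eq u_def m_def
    by (simp add: K_index)
  then show "(x - 1) * char_poly C = (x ^ 2 + x + 1) * (x ^ (n + 1) * (x ^ 2 - x - 1) + (x ^ 2 + x - 1))"
    using det_star_weighting[OF m, of "n - 1"] unfolding N by simp
qed

lemma expanded_form:
  fixes x :: "'a :: comm_ring_1"
  assumes "n \<ge> 3"
  shows "(x - 1) * (x ^ (n + 4) + x ^ (n + 3) - 2 * x ^ (n + 1) - 3 * (\<Sum>i = 4..n. x ^ i) - 2 * x ^ 3 + x + 1)
       = x ^ (n + 1) * (x ^ 4 - x ^ 2 - 2 * x - 1) + (x ^ 4 + 2 * x ^ 3 + x ^ 2 - 1)"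
proof -
  let ?S = "\<Sum>i = 4..n. x ^ i"
  have geometric: "(x - 1) * ?S = x ^ (n + 1) - x ^ 4"
    using assms by (induction n rule: nat_induct_at_least) (auto simp: algebra_simps)
  have "(x - 1) * (x ^ (n + 4) + x ^ (n + 3) - 2 * x ^ (n + 1) - 3 * ?S - 2 * x ^ 3 + x + 1)
      = (x - 1) * (x ^ (n + 4) + x ^ (n + 3) - 2 * x ^ (n + 1) - 2 * x ^ 3 + x + 1) - 3 * ((x - 1) * ?S)"
    by (simp add: algebra_simps)
  also have "\<dots> = x ^ (n + 1) * (x ^ 4 - x ^ 2 - 2 * x - 1) + (x ^ 4 + 2 * x ^ 3 + x ^ 2 - 1)"
    unfolding geometric by (simp add: eval_nat_numeral algebra_simps)
  finally show ?thesis .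
qed

lemma factored_form:
  fixes x y :: "'a :: comm_ring_1"
  shows "(x ^ 2 + x + 1) * (y * (x ^ 2 - x - 1) + (x ^ 2 + x - 1))
       = y * (x ^ 4 - x ^ 2 - 2 * x - 1) + (x ^ 4 + 2 * x ^ 3 + x ^ 2 - 1)"
  by (simp add: eval_nat_numeral algebra_simps)

section \<open>The largest eigenvalue\<close>

definition golden :: real where
  "golden = (sqrt 5 + 1) / 2"

lemma golden_eq: "golden ^ 2 = golden + 1" and golden_bounds: "3 / 2 < golden" "golden < 2"
proof -
  show "golden ^ 2 = golden + 1"
    by (simp add: golden_def power2_eq_square field_simps)
  show "3 / 2 < golden" "golden < 2"
    unfolding golden_def using real_less_rsqrt[of 2 5] real_less_lsqrt[of 3 5] by simp_all
qed

lemma golden_roots: "{t :: real. t ^ 2 - t - 1 = 0} = {golden, 1 - golden}"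
proof -
  have "t ^ 2 - t - 1 = (t - golden) * (t - (1 - golden))" for t :: real
    using golden_eq by (simp add: algebra_simps power2_eq_square)
  then show ?thesis by auto
qed

lemma eventually_power_greater:
  fixes x c :: real
  assumes "x > 1"
  shows "\<forall>\<^sub>F n in sequentially. c < x ^ n"
proof -
  obtain k where "c < x ^ k"
    using real_arch_pow[OF assms] by blast
  then show ?thesis
    using assms unfolding eventually_sequentially
    by (meson less_imp_le order_less_le_trans power_increasing)
qed

text \<open>
  If \<open>r = norm z \<ge> golden + \<epsilon>\<close>, then \<open>z\<^sup>2 - z - 1 = (z - golden) (z - (1 - golden))\<close> has modulus at least
  \<open>\<epsilon> r / 2\<close>, whereas \<open>z\<^sup>2 + z - 1\<close> has modulus below \<open>3 r\<^sup>2\<close>. Keeping the factor \<open>r\<close> in the lower bound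
  is what makes the comparison uniform in \<open>z\<close>: with \<open>r ^ (n + 1) \<ge> r * golden ^ n\<close> the powers of \<open>r\<close>
  cancel, and \<open>golden ^ n < 6 / \<epsilon>\<close> remains.
\<close>

lemma no_large_roots:
  assumes "\<epsilon> > 0"
  shows "\<forall>\<^sub>F n in sequentially. \<forall>z :: complex.
           z ^ (n + 1) * (z ^ 2 - z - 1) + (z ^ 2 + z - 1) = 0 \<longrightarrow> norm z < golden + \<epsilon>"
proof -
  have "\<forall>\<^sub>F n in sequentially. 6 / \<epsilon> < golden ^ n"
    using golden_bounds by (intro eventually_power_greater) simp
  then show ?thesis
  proof (rule eventually_mono)
    fix n :: nat
    assume n: "6 / \<epsilon> < golden ^ n"
    show "\<forall>z :: complex. z ^ (n + 1) * (z ^ 2 - z - 1) + (z ^ 2 + z - 1) = 0 \<longrightarrow> norm z < golden + \<epsilon>"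
    proof (intro allI impI, rule ccontr)
      fix z :: complex
      assume large: "\<not> norm z < golden + \<epsilon>"
        and root: "z ^ (n + 1) * (z ^ 2 - z - 1) + (z ^ 2 + z - 1) = 0"
      define r where "r = norm z"
      have r: "r \<ge> golden + \<epsilon>" "r > 1"
        using large golden_bounds assms by (auto simp: r_def)
      have factors: "z ^ 2 - z - 1 = (z - of_real golden) * (z - of_real (1 - golden))"
      proof -
        have "of_real golden * of_real golden = (of_real golden + 1 :: complex)"
          using golden_eq unfolding power2_eq_square by (metis of_real_1 of_real_add of_real_mult)
        then show ?thesis by (simp add: algebra_simps power2_eq_square)
      qed
      have "r - golden \<le> norm (z - of_real golden)"
        using norm_triangle_ineq2[of z "of_real golden"] golden_bounds by (simp add: r_def)
      moreover have "r - (golden - 1) \<le> norm (z - of_real (1 - golden))"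
        using norm_triangle_ineq2[of z "of_real (1 - golden)"] golden_bounds
        unfolding r_def norm_of_real by simp
      ultimately have quadratic: "\<epsilon> * (r / 2) \<le> norm (z ^ 2 - z - 1)"
        unfolding factors norm_mult using r golden_bounds assms by (intro mult_mono) auto
      have power: "r * golden ^ n \<le> r ^ (n + 1)"
        using r golden_bounds assms by (auto intro!: mult_left_mono power_mono)
      have "r < r ^ 2"
        using r(2) by (simp add: power2_eq_square)
      have "r * golden ^ n * (\<epsilon> * (r / 2)) \<le> norm (z ^ (n + 1) * (z ^ 2 - z - 1))"
        unfolding norm_mult norm_power r_def[symmetric]
        using r assms quadratic power golden_bounds by (intro mult_mono) auto
      also have "z ^ (n + 1) * (z ^ 2 - z - 1) = - (z ^ 2 + z - 1)"
        using root by (simp only: eq_neg_iff_add_eq_0)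
      also have "norm (- (z ^ 2 + z - 1)) \<le> r ^ 2 + r + 1"
        unfolding norm_minus_cancel
        using norm_triangle_ineq4[of "z ^ 2 + z" 1] norm_triangle_ineq[of "z ^ 2" z]
        by (simp add: r_def norm_power)
      also have "\<dots> < 3 * r ^ 2"
        using \<open>r < r ^ 2\<close> r(2) by linarith
      finally have "r ^ 2 * (golden ^ n * \<epsilon>) < r ^ 2 * 6"
        by (simp add: power2_eq_square algebra_simps)
      then have "golden ^ n * \<epsilon> < 6"
        using r by simp
      then show False
        using n assms by (simp add: field_simps)
    qed
  qed
qed

text \<open>
  The left-hand side is positive at the golden ratio, where \<open>t\<^sup>2 - t - 1\<close> vanishes, and for large \<open>n\<close>
  negative at any fixed \<open>s\<close> with \<open>1 < s < golden\<close>, where \<open>t\<^sup>2 - t - 1\<close> is negative.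
\<close>

lemma root_near_golden:
  assumes "\<epsilon> > 0"
  shows "\<forall>\<^sub>F n in sequentially. \<exists>t :: real. golden - \<epsilon> < t \<and> 1 < t \<and>
           t ^ (n + 1) * (t ^ 2 - t - 1) + (t ^ 2 + t - 1) = 0"
proof -
  define s where "s = max (golden - \<epsilon> / 2) (3 / 2)"
  have s: "golden - \<epsilon> < s" "3 / 2 \<le> s" "s < golden"
    using assms golden_bounds by (auto simp: s_def)
  define \<delta> where "\<delta> = - (s ^ 2 - s - 1)"
  have "\<delta> = (golden - s) * (s + golden - 1)"
    using golden_eq by (simp add: \<delta>_def power2_eq_square algebra_simps)
  then have \<delta>: "\<delta> > 0"
    using s golden_bounds by simp
  \<comment> \<open>The \<open>5\<close> bounds \<open>t\<^sup>2 + t - 1\<close> for \<open>t < 2\<close>.\<close>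
  have "\<forall>\<^sub>F n in sequentially. 5 / \<delta> < s ^ n"
    using s by (intro eventually_power_greater) simp
  then show ?thesis
  proof (rule eventually_mono)
    fix n :: nat
    assume n: "5 / \<delta> < s ^ n"
    define g where "g t = t ^ (n + 1) * (t ^ 2 - t - 1) + (t ^ 2 + t - 1)" for t :: real
    have "s ^ n \<le> s ^ (n + 1)"
      using s by (intro power_increasing) auto
    then have "5 / \<delta> < s ^ (n + 1)"
      using n by linarith
    then have "5 < s ^ (n + 1) * \<delta>"
      using \<delta> by (simp add: field_simps)
    moreover have "s ^ 2 < 4" "s < 2"
      using s golden_bounds power_strict_mono[of s 2 2] by auto
    moreover have "g s = - (s ^ (n + 1) * \<delta>) + (s ^ 2 + s - 1)"
      unfolding g_def \<delta>_def by (simp add: algebra_simps)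
    ultimately have "g s \<le> 0"
      by simp
    moreover have "0 \<le> g golden"
      using golden_bounds by (simp add: g_def golden_eq)
    moreover have "continuous_on {s..golden} g"
      unfolding g_def by (intro continuous_intros)
    ultimately obtain t where "s \<le> t" "t \<le> golden" "g t = 0"
      using IVT'[of g s 0 golden] s by auto
    then show "\<exists>t. golden - \<epsilon> < t \<and> 1 < t \<and> t ^ (n + 1) * (t ^ 2 - t - 1) + (t ^ 2 + t - 1) = 0"
      using s unfolding g_def by (intro exI[of _ t]) auto
  qed
qed

lemma char_poly_root_iff:
  fixes z :: complex
  assumes C: "is_coxeter_transformation (star_cartan 3 3 n) C" and n: "n \<ge> 1" and "z \<noteq> 1"
  shows "eigenvalue (map_mat complex_of_int C) z \<longleftrightarrow>
           (z ^ 2 + z + 1) * (z ^ (n + 1) * (z ^ 2 - z - 1) + (z ^ 2 + z - 1)) = 0"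
proof -
  note C' = char_poly_star_3_3[OF C n]
  let ?h = "map_poly complex_of_int"
  let ?x = "[:0, 1:] :: int poly"
  have "?h ((?x - 1) * char_poly C)
      = ?h ((?x ^ 2 + ?x + 1) * (?x ^ (n + 1) * (?x ^ 2 - ?x - 1) + (?x ^ 2 + ?x - 1)))"
    unfolding C'(2) ..
  then have "poly (?h ((?x - 1) * char_poly C)) z
      = poly (?h ((?x ^ 2 + ?x + 1) * (?x ^ (n + 1) * (?x ^ 2 - ?x - 1) + (?x ^ 2 + ?x - 1)))) z"
    by simp
  then have "(z - 1) * poly (?h (char_poly C)) z
      = (z ^ 2 + z + 1) * (z ^ (n + 1) * (z ^ 2 - z - 1) + (z ^ 2 + z - 1))"
    by (simp add: hom_distribs)
  moreover have "char_poly (map_mat complex_of_int C) = ?h (char_poly C)"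
    by (rule of_int_hom.char_poly_hom[OF C'(1)])
  moreover have "map_mat complex_of_int C \<in> carrier_mat (n + 4) (n + 4)"
    using C'(1) by simp
  ultimately show ?thesis
    using \<open>z \<noteq> 1\<close> eigenvalue_root_char_poly by (metis mult_eq_0_iff right_minus_eq)
qed

lemma spectral_radius_tendsto_golden:
  fixes C :: "nat \<Rightarrow> int mat"
  assumes C: "\<And>n. n \<ge> 3 \<Longrightarrow> is_coxeter_transformation (star_cartan 3 3 n) (C n)"
  shows "(\<lambda>n. spectral_radius (map_mat complex_of_int (C n))) \<longlonglongrightarrow> golden"
proof (rule tendstoI)
  fix \<epsilon> :: real
  assume \<epsilon>: "\<epsilon> > 0"
  show "\<forall>\<^sub>F n in sequentially. dist (spectral_radius (map_mat complex_of_int (C n))) golden < \<epsilon>"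
    using no_large_roots[OF \<epsilon>] root_near_golden[OF \<epsilon>] eventually_ge_at_top[of 3]
  proof eventually_elim
    case (elim n)
    let ?A = "map_mat complex_of_int (C n)"
    have A: "?A \<in> carrier_mat (n + 4) (n + 4)"
      using char_poly_star_3_3(1)[OF C] elim by simp
    have ev: "eigenvalue ?A z \<longleftrightarrow>
        (z ^ 2 + z + 1) * (z ^ (n + 1) * (z ^ 2 - z - 1) + (z ^ 2 + z - 1)) = 0" if "z \<noteq> 1" for z
      using char_poly_root_iff[OF C _ that] elim by simp
    have "spectral_radius ?A \<in> norm ` spectrum ?A"
      by (rule spectral_radius_mem_max[OF A]) simp
    then obtain z where z: "eigenvalue ?A z" "spectral_radius ?A = norm z"
      by (auto simp: spectrum_def)
    have upper: "norm z < golden + \<epsilon>"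
    proof (cases "z ^ 2 + z + 1 = 0 \<or> z = 1")
      case True
      moreover have "z ^ 3 - 1 = (z - 1) * (z ^ 2 + z + 1)"
        by (simp add: eval_nat_numeral algebra_simps)
      ultimately have "z ^ 3 = 1" by auto
      then have "norm z ^ 3 = 1"
        by (metis norm_one norm_power)
      then have "norm z = 1"
        using power_eq_iff_eq_base[of 3 "norm z" 1] by simp
      then show ?thesis
        using golden_bounds \<epsilon> by simp
    next
      case False
      then show ?thesis
        using z(1) ev elim(1) by auto
    qed
    obtain t :: real where t: "golden - \<epsilon> < t" "1 < t"
        "t ^ (n + 1) * (t ^ 2 - t - 1) + (t ^ 2 + t - 1) = 0"
      using elim(2) by blast
    have "of_real (t ^ (n + 1) * (t ^ 2 - t - 1) + (t ^ 2 + t - 1)) = (0 :: complex)"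
      unfolding t(3) by simp
    then have "eigenvalue ?A (of_real t)"
      using t(2) by (subst ev) auto
    then have "norm (of_real t :: complex) \<in> norm ` spectrum ?A"
      unfolding spectrum_def by (intro imageI) simp
    then have "norm (of_real t :: complex) \<le> spectral_radius ?A"
      by (rule spectral_radius_mem_max(2)[OF A, rotated]) simp
    then show ?case
      using upper t z(2) by (auto simp: dist_real_def)
  qed
qed

theorem proposition4p17:
  fixes C :: "nat \<Rightarrow> int mat"
  assumes "\<And>n. n \<ge> 3 \<Longrightarrow> is_coxeter_transformation (star_cartan 3 3 n) (C n)"
  shows
    "(\<forall>n\<ge>3. let x = [:0, 1:] :: int poly; \<chi> = char_poly (C n) in
       \<chi> = x ^ (n + 4) + x ^ (n + 3) - 2 * x ^ (n + 1) - 3 * (\<Sum>i = 4..n. x ^ i) - 2 * x ^ 3 + x + 1 \<and>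
       to_fract \<chi> =
         Fract (x ^ (n + 1) * (x ^ 4 - x ^ 2 - 2 * x - 1) + (x ^ 4 + 2 * x ^ 3 + x ^ 2 - 1)) (x - 1) \<and>
       to_fract \<chi> =
         Fract ((x ^ 2 + x + 1) * (x ^ (n + 1) * (x ^ 2 - x - 1) + (x ^ 2 + x - 1))) (x - 1)) \<and>
     (\<lambda>n. spectral_radius (map_mat complex_of_int (C n)))
       \<longlonglongrightarrow> Max {t :: real. t ^ 2 - t - 1 = 0} \<and>
     Max {t :: real. t ^ 2 - t - 1 = 0} = (sqrt 5 + 1) / 2 \<and>
     \<bar>(sqrt 5 + 1) / 2 - 1.618034\<bar> < 5 / (10 ^ 7 :: real)"
proof (intro conjI allI impI)
  fix n :: nat
  assume n: "n \<ge> 3"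
  define x where "x = ([:0, 1:] :: int poly)"
  define \<chi> where "\<chi> = char_poly (C n)"
  have nz: "x - 1 \<noteq> 0"
    by (simp add: x_def one_pCons)
  have factored: "(x - 1) * \<chi> = (x ^ 2 + x + 1) * (x ^ (n + 1) * (x ^ 2 - x - 1) + (x ^ 2 + x - 1))"
    using char_poly_star_3_3(2)[OF assms[OF n]] n by (simp only: x_def \<chi>_def)
  then have unfactored: "(x - 1) * \<chi>
      = x ^ (n + 1) * (x ^ 4 - x ^ 2 - 2 * x - 1) + (x ^ 4 + 2 * x ^ 3 + x ^ 2 - 1)"
    unfolding factored_form .
  have "(x - 1) * \<chi> = (x - 1) *
      (x ^ (n + 4) + x ^ (n + 3) - 2 * x ^ (n + 1) - 3 * (\<Sum>i = 4..n. x ^ i) - 2 * x ^ 3 + x + 1)"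
    unfolding expanded_form[OF n] by (rule unfactored)
  then have expanded: "\<chi> = x ^ (n + 4) + x ^ (n + 3) - 2 * x ^ (n + 1) - 3 * (\<Sum>i = 4..n. x ^ i)
      - 2 * x ^ 3 + x + 1"
    using nz by (simp only: mult_cancel_left) simp
  have fraction: "to_fract \<chi> = Fract p (x - 1)" if "(x - 1) * \<chi> = p" for p
    using that nz by (simp add: to_fract_def eq_fract mult.commute)
  show "let x = [:0, 1:] :: int poly; \<chi> = char_poly (C n) in
       \<chi> = x ^ (n + 4) + x ^ (n + 3) - 2 * x ^ (n + 1) - 3 * (\<Sum>i = 4..n. x ^ i) - 2 * x ^ 3 + x + 1 \<and>
       to_fract \<chi> =
         Fract (x ^ (n + 1) * (x ^ 4 - x ^ 2 - 2 * x - 1) + (x ^ 4 + 2 * x ^ 3 + x ^ 2 - 1)) (x - 1) \<and>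
       to_fract \<chi> =
         Fract ((x ^ 2 + x + 1) * (x ^ (n + 1) * (x ^ 2 - x - 1) + (x ^ 2 + x - 1))) (x - 1)"
    unfolding Let_def x_def[symmetric] \<chi>_def[symmetric]
    using expanded fraction[OF unfactored] fraction[OF factored] by blast
next
  have Max: "Max {t :: real. t ^ 2 - t - 1 = 0} = golden"
    unfolding golden_roots using golden_bounds by simp
  show "Max {t :: real. t ^ 2 - t - 1 = 0} = (sqrt 5 + 1) / 2"
    unfolding Max golden_def ..
  show "(\<lambda>n. spectral_radius (map_mat complex_of_int (C n))) \<longlonglongrightarrow> Max {t :: real. t ^ 2 - t - 1 = 0}"
    unfolding Max by (rule spectral_radius_tendsto_golden[OF assms])
next
  have "2.236067 < sqrt 5" "sqrt 5 < 2.236068"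
    by (rule real_less_rsqrt real_less_lsqrt; simp add: power2_eq_square)+
  then show "\<bar>(sqrt 5 + 1) / 2 - 1.618034\<bar> < 5 / (10 ^ 7 :: real)"
    by (auto simp: abs_less_iff)
qed

end
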